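(* For every integer $n \geq 1$, the graph $(K_9 - C_9)^n$ is pancyclic; that is, for every integer $l$ with $3 \leq l \leq 9^n$, the graph $(K_9-C_9)^n$ contains a cycle of length $l$ as a subgraph.
   Context: All graphs are finite, simple and undirected. $K_9$ denotes the complete graph on 9 vertices, and $K_9 - C_9$ denotes the graph on the same 9 vertices obtained from $K_9$ by deleting the edges of a cycle $C_9$ of length 9 (a cycle passing through all 9 vertices). The Cartesian product of graphs $G$ and $H$ is the graph with vertex set $V(G)\times V(H)$ in which $(g,h)$ and $(g',h')$ are adjacent if and only if either $g=g'$ and $hh'\in E(H)$, or $h=h'$ and $gg'\in E(G)$. The graph $(K_9-C_9)^n$ is defined recursively by $(K_9-C_9)^1 = K_9-C_9$ and, for $n\geq 2$, $(K_9-C_9)^n$ is the Cartesian product of $K_9-C_9$ with $(K_9-C_9)^{n-1}$; it has $9^n$ vertices. A graph $G$ on $m$ vertices is pancyclic if it contains, as a (not necessarily induced) subgraph, a cycle of length $l$ for every integer $l$ with $3\leq l\leq m$. *)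

theory Defs
  imports "Graph_Theory.Graph_Theory"
begin

text \<open>
  A finite simple undirected graph is a \<^locale>\<open>pair_graph\<close>: a finite, loop-free, symmetric digraph
  without parallel arcs, where the edge \<open>uv\<close> is the pair of arcs \<open>(u, v)\<close> and \<open>(v, u)\<close>.
\<close>

definition complete_graph :: "nat \<Rightarrow> nat pair_pre_digraph" where
  "complete_graph n =
     \<lparr> pverts = {..<n}, parcs = {(u, v). u \<in> {..<n} \<and> v \<in> {..<n} \<and> u \<noteq> v} \<rparr>"

definition cycle_graph :: "nat \<Rightarrow> nat pair_pre_digraph" where
  "cycle_graph n =
     \<lparr> pverts = {..<n},
       parcs = {(i, Suc i mod n) | i. i < n} \<union> {(Suc i mod n, i) | i. i < n} \<rparr>"

definition delete_edges :: "'a pair_pre_digraph \<Rightarrow> 'a rel \<Rightarrow> 'a pair_pre_digraph" where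
  "delete_edges G F = \<lparr> pverts = pverts G, parcs = parcs G - F \<rparr>"

definition K9_minus_C9 :: "nat pair_pre_digraph" where
  "K9_minus_C9 = delete_edges (complete_graph 9) (parcs (cycle_graph 9))"

definition cart_prod ::
  "'a pair_pre_digraph \<Rightarrow> 'b pair_pre_digraph \<Rightarrow> ('a \<times> 'b) pair_pre_digraph" where
  "cart_prod G H =
     \<lparr> pverts = pverts G \<times> pverts H,
       parcs = {((g, h), (g', h')).
          g \<in> pverts G \<and> g' \<in> pverts G \<and> h \<in> pverts H \<and> h' \<in> pverts H \<and>
          (g = g' \<and> (h, h') \<in> parcs H \<or> h = h' \<and> (g, g') \<in> parcs G)} \<rparr>"

definition relabel :: "('a \<Rightarrow> 'b) \<Rightarrow> 'a pair_pre_digraph \<Rightarrow> 'b pair_pre_digraph" where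
  "relabel f G = \<lparr> pverts = f ` pverts G, parcs = map_prod f f ` parcs G \<rparr>"

text \<open>
  The vertex type of an iterated product would grow with the exponent. To have one type for all
  powers, the nested tuple \<open>(x\<^sub>1, (x\<^sub>2, \<dots>, x\<^sub>n))\<close> is renamed to the list \<open>[x\<^sub>1, \<dots>, x\<^sub>n]\<close>; the
  relabelling maps are injective on the graphs concerned. The value at exponent 0, which only
  serves totality, is the one-vertex graph.
\<close>

fun cart_power :: "'a pair_pre_digraph \<Rightarrow> nat \<Rightarrow> 'a list pair_pre_digraph" where
  "cart_power G 0 = \<lparr> pverts = {[]}, parcs = {} \<rparr>"
| "cart_power G (Suc 0) = relabel (\<lambda>x. [x]) G"
| "cart_power G (Suc (Suc n)) =
     relabel (\<lambda>(x, xs). x # xs) (cart_prod G (cart_power G (Suc n)))"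

text \<open>
  \<^const>\<open>pre_digraph.cycle\<close> is a nonempty closed walk, given by its list of arcs, that repeats no
  vertex other than its endpoint. In a symmetric digraph, \<open>u, v, u\<close> is such a cycle of length 2; for
  length at least 3, these are exactly the cycles of the undirected graph.
\<close>

definition pancyclic :: "'a pair_pre_digraph \<Rightarrow> bool" where
  "pancyclic G \<longleftrightarrow>
     (\<forall>l. 3 \<le> l \<and> l \<le> card (pverts G) \<longrightarrow>
        (\<exists>p. pre_digraph.cycle (with_proj G) p \<and> length p = l))"

lemma complete_graph_complete: "complete_digraph n (with_proj (complete_graph n))"
  by (auto simp: complete_digraph_pair_def complete_graph_def)

lemma cycle_graph_subset_complete_graph:
  assumes "n \<ge> 2"
  shows "parcs (cycle_graph n) \<subseteq> parcs (complete_graph n)"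
proof -
  have "i \<noteq> Suc i mod n" if "i < n" for i
    using that assms by (cases "Suc i = n") auto
  then show ?thesis
    using assms by (fastforce simp: cycle_graph_def complete_graph_def)
qed

lemma pair_graphI:
  assumes "finite (pverts G)" "parcs G \<subseteq> pverts G \<times> pverts G"
    and "\<And>u v. (u, v) \<in> parcs G \<Longrightarrow> (v, u) \<in> parcs G" "\<And>u. (u, u) \<notin> parcs G"
  shows "pair_graph G"
proof
  show "finite (parcs G)"
    using assms(1,2) by (meson finite_SigmaI finite_subset)
  show "symmetric (with_proj G)"
    using assms(3) by (auto simp: symmetric_def intro!: symI)
  show "fst e \<noteq> snd e" if "e \<in> parcs G" for e
    using assms(4) that by (metis prod.collapse)
qed (use assms(1,2) in auto)

lemma pair_graphD:
  assumes "pair_graph G"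
  shows "finite (pverts G)" "parcs G \<subseteq> pverts G \<times> pverts G"
    and "\<And>u v. (u, v) \<in> parcs G \<Longrightarrow> (v, u) \<in> parcs G" "\<And>u. (u, u) \<notin> parcs G"
proof -
  interpret pair_graph G by (fact assms)
  show "finite (pverts G)" by (rule pair_finite_verts)
  show "parcs G \<subseteq> pverts G \<times> pverts G" by (auto dest: in_arcsD1 in_arcsD2)
  show "(v, u) \<in> parcs G" if "(u, v) \<in> parcs G" for u v
    using pair_sym_arcs that by (auto simp: symmetric_def dest: symD)
  show "(u, u) \<notin> parcs G" for u
    using pair_no_loops by fastforce
qed

lemma pair_graph_K9_minus_C9: "pair_graph K9_minus_C9"
  by (rule pair_graphI)
    (auto simp: K9_minus_C9_def delete_edges_def complete_graph_def cycle_graph_def)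

lemma pair_graph_cart_prod:
  assumes "pair_graph G" "pair_graph H"
  shows "pair_graph (cart_prod G H)"
  by (rule pair_graphI)
    (use pair_graphD[OF assms(1)] pair_graphD[OF assms(2)] in \<open>auto simp: cart_prod_def\<close>)

lemma pair_graph_relabel:
  assumes "pair_graph G" "inj f"
  shows "pair_graph (relabel f G)"
proof (rule pair_graphI)
  note G = pair_graphD[OF assms(1)]
  show "finite (pverts (relabel f G))"
    using G(1) by (simp add: relabel_def)
  show "parcs (relabel f G) \<subseteq> pverts (relabel f G) \<times> pverts (relabel f G)"
    using G(2) by (auto simp: relabel_def)
  show "(v, u) \<in> parcs (relabel f G)" if "(u, v) \<in> parcs (relabel f G)" for u v
    using that G(3) by (force simp: relabel_def)
  show "(u, u) \<notin> parcs (relabel f G)" for u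
    using G(4) assms(2) by (auto simp: relabel_def dest: injD)
qed

lemma inj_relabelling: "inj (\<lambda>x. [x])" "inj (\<lambda>(x, xs). x # xs)"
  by (auto simp: inj_def)

lemma pair_graph_cart_power: "pair_graph G \<Longrightarrow> pair_graph (cart_power G n)"
proof (induction G n rule: cart_power.induct)
  case (1 G)
  show ?case by (rule pair_graphI) auto
next
  case (2 G)
  then show ?case by (simp add: pair_graph_relabel inj_relabelling)
next
  case (3 G n)
  then show ?case by (simp add: pair_graph_relabel pair_graph_cart_prod inj_relabelling)
qed

lemma card_cart_power: "card (pverts (cart_power G n)) = card (pverts G) ^ n"
proof (induction G n rule: cart_power.induct)
  case (1 G)
  show ?case by simp
next
  case (2 G)
  show ?case by (simp add: relabel_def card_image inj_on_def)
next
  case (3 G n)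
  have "inj_on (\<lambda>(x, xs). x # xs) A" for A :: "('a \<times> 'a list) set"
    by (auto simp: inj_on_def)
  then show ?case
    using 3 by (simp add: relabel_def cart_prod_def card_image card_cartesian_product)
qed

lemma card_cart_power_K9_minus_C9: "card (pverts (cart_power K9_minus_C9 n)) = 9 ^ n"
  by (simp add: card_cart_power K9_minus_C9_def delete_edges_def complete_graph_def)

end

theory Submission
  imports Defs
begin

text \<open>
  Every edge \<open>ab\<close> of \<open>G = K\<^sub>9 - C\<^sub>9\<close> is joined by paths on \<open>k\<close> vertices for all \<open>2 \<le> k \<le> 9\<close>. Given a
  Hamiltonian path of \<open>H\<close>, the product of \<open>G\<close> with it is a stack of copies of \<open>G\<close>. A cycle using an edge
  \<open>ab\<close> of the top copy is lengthened by any such \<open>k\<close>: replace \<open>ab\<close> by a detour through an \<open>a\<close>-\<open>b\<close> path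
  on \<open>k\<close> vertices of the next copy. The new cycle again uses an edge of the top copy, so all
  lengths are reached, and the longest of these cycles provides a Hamiltonian path of the product.
\<close>

section \<open>Paths as vertex lists, and the cycles they close\<close>

definition path_between :: "'a pair_pre_digraph \<Rightarrow> 'a \<Rightarrow> 'a list \<Rightarrow> 'a \<Rightarrow> bool" where
  "path_between G a p b \<longleftrightarrow>
     p \<noteq> [] \<and> hd p = a \<and> last p = b \<and> distinct p \<and> set p \<subseteq> pverts G \<and>
     successively (\<lambda>u v. (u, v) \<in> parcs G) p"

text \<open>The path for \<open>k = 2\<close> is the edge itself; the others close up to the cycles through it.\<close>

definition edge_pancyclic :: "'a pair_pre_digraph \<Rightarrow> bool" where
  "edge_pancyclic G \<longleftrightarrow>
     (\<forall>(a, b) \<in> parcs G. \<forall>k. 2 \<le> k \<and> k \<le> card (pverts G) \<longrightarrow>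
        (\<exists>p. path_between G a p b \<and> length p = k))"

lemma edge_pancyclicD:
  assumes "edge_pancyclic G" "(a, b) \<in> parcs G" "2 \<le> k" "k \<le> card (pverts G)"
  obtains p where "path_between G a p b" "length p = k"
  using assms unfolding edge_pancyclic_def by blast

lemma path_between_rev:
  assumes "pair_graph G" "path_between G a p b"
  shows "path_between G b (rev p) a"
proof -
  have "successively (\<lambda>u v. (u, v) \<in> parcs G) p"
    using assms(2) by (simp add: path_between_def)
  then have "successively (\<lambda>u v. (v, u) \<in> parcs G) p"
    by (rule successively_mono) (rule pair_graphD(3)[OF assms(1)])
  then show ?thesis
    using assms(2) by (simp add: path_between_def hd_rev last_rev)
qed

lemma path_between_append:
  assumes "path_between G a p b" "path_between G c q d" "(b, c) \<in> parcs G" "set p \<inter> set q = {}"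
  shows "path_between G a (p @ q) d"
  using assms by (auto simp: path_between_def successively_append_iff)

lemma path_between_map:
  assumes "path_between G a p b" "inj_on f (pverts G)" "f ` pverts G \<subseteq> pverts H"
    and "\<And>u v. (u, v) \<in> parcs G \<Longrightarrow> (f u, f v) \<in> parcs H"
  shows "path_between H (f a) (map f p) (f b)"
proof -
  have p: "p \<noteq> []" "hd p = a" "last p = b" "distinct p" "set p \<subseteq> pverts G"
    "successively (\<lambda>u v. (u, v) \<in> parcs G) p"
    using assms(1) by (auto simp: path_between_def)
  moreover have "successively (\<lambda>u v. (f u, f v) \<in> parcs H) p"
    by (rule successively_mono[OF p(6)]) (rule assms(4))
  moreover have "inj_on f (set p)" "f ` set p \<subseteq> pverts H"
    using p(5) assms(2,3) by (auto intro: inj_on_subset)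
  ultimately show ?thesis
    by (simp add: path_between_def hd_map last_map distinct_map successively_map)
qed

text \<open>In \<open>with_proj G\<close> tail and head are \<open>fst\<close> and
  \<open>snd\<close>, so consecutive pairs of any nonempty vertex list chain up; that they are arcs
  of \<open>G\<close> is a separate condition.\<close>

lemma awalk_vwalk_arcs:
  assumes "p \<noteq> []"
  shows "pre_digraph.awalk_verts (with_proj G) (hd p) (vwalk_arcs p) = p"
    and "pre_digraph.cas (with_proj G) (hd p) (vwalk_arcs p) (last p)"
  using assms
  by (induction p rule: vwalk_arcs.induct)
    (simp_all add: pre_digraph.awalk_verts.simps pre_digraph.cas.simps)

lemma set_vwalk_arcs_subset_iff:
  "set (vwalk_arcs p) \<subseteq> A \<longleftrightarrow> successively (\<lambda>u v. (u, v) \<in> A) p"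
  by (induction p rule: vwalk_arcs.induct) auto

lemma cycle_if_path_between:
  assumes "path_between G a p b" "(b, a) \<in> parcs G"
  shows "\<exists>c. pre_digraph.cycle (with_proj G) c \<and> length c = length p"
proof -
  \<comment> \<open>Repeating \<open>a\<close> adds the closing arc, so there are as many arcs as
    vertices of \<open>p\<close>.\<close>
  let ?q = "p @ [a]"
  have p: "p \<noteq> []" "hd p = a" "last p = b" "distinct p" "set p \<subseteq> pverts G"
    "successively (\<lambda>u v. (u, v) \<in> parcs G) p"
    using assms(1) by (auto simp: path_between_def)
  have "pre_digraph.awalk_verts (with_proj G) a (vwalk_arcs ?q) = ?q"
    "pre_digraph.cas (with_proj G) a (vwalk_arcs ?q) a"
    using awalk_vwalk_arcs[of ?q G] p by simp_all
  moreover have "set (vwalk_arcs ?q) \<subseteq> parcs G"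
    unfolding set_vwalk_arcs_subset_iff using p assms(2) by (simp add: successively_append_iff)
  moreover have "length (vwalk_arcs ?q) = length p"
    using vwalk_length_simp[of ?q] unfolding vwalk_length_def by simp
  moreover have "a \<in> pverts G" "distinct (tl ?q)" "vwalk_arcs ?q \<noteq> []"
    using p calculation by (cases p; auto)+
  ultimately show ?thesis
    unfolding pre_digraph.cycle_def pre_digraph.awalk_def
    by (metis with_proj_simps(1) with_proj_simps(2))
qed

section \<open>Paths with adjacent ends in a product\<close>

lemma path_between_cart_prod_row:
  assumes "path_between G a p b" "y \<in> pverts H"
  shows "path_between (cart_prod G H) (a, y) (map (\<lambda>x. (x, y)) p) (b, y)"
  using assms
  by (auto simp: path_between_def cart_prod_def hd_map last_map distinct_map inj_on_def
      successively_map intro: successively_mono)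

text \<open>Such a path is a cycle minus an edge of the top copy, the one over \<open>y\<close>. The
  induction adds one copy of \<open>G\<close> on top at a time; confining \<open>p\<close> to the
  copies over \<open>ys\<close> keeps it disjoint from the added copy.\<close>

lemma cart_prod_path_paths:
  assumes G: "pair_graph G" "edge_pancyclic G" "card (pverts G) \<ge> 3" "parcs G \<noteq> {}"
    and H: "pair_graph H"
    and "path_between H y ys z" "2 \<le> l" "l \<le> card (pverts G) * length ys"
  shows "\<exists>a b p. (a, b) \<in> parcs G \<and> path_between (cart_prod G H) (a, y) p (b, y) \<and>
           snd ` set p \<subseteq> set ys \<and> length p = l"
  using assms(6-8)
proof (induction ys arbitrary: y l)
  case Nil
  then show ?case by (simp add: path_between_def)
next
  case (Cons y' ys)
  let ?m = "card (pverts G)"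
  have y: "y' = y" "y \<in> pverts H" "y \<notin> set ys"
    using Cons.prems(1) by (auto simp: path_between_def)
  show ?case
  proof (cases "l \<le> ?m")
    case True
    obtain a b where ab: "(a, b) \<in> parcs G"
      using G(4) by auto
    then obtain p where "path_between G a p b" "length p = l"
      using edge_pancyclicD[OF G(2)] Cons.prems(2) True by blast
    then show ?thesis
      using ab path_between_cart_prod_row[of G a p b y H] y
      by (intro exI[of _ a] exI[of _ b] exI[of _ "map (\<lambda>x. (x, y)) p"]) auto
  next
    case False
    \<comment> \<open>The lower copies take as many vertices as they can hold while at least 2
      remain for the top one. Since \<open>l > ?m \<ge> 3\<close>, also
      \<open>l - 2 \<ge> 2\<close>.\<close>
    define l' where "l' = min (?m * length ys) (l - 2)"
    have ne: "ys \<noteq> []"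
      using False Cons.prems by auto
    then have "?m \<le> ?m * length ys"
      by (cases ys) auto
    moreover have "l \<le> ?m + ?m * length ys"
      using Cons.prems(3) by simp
    ultimately have l': "2 \<le> l'" "l' \<le> ?m * length ys" "l' \<le> l" "2 \<le> l - l'" "l - l' \<le> ?m"
      using False G(3) unfolding l'_def by linarith+
    have "path_between H (hd ys) ys z" and arc: "(y, hd ys) \<in> parcs H"
      using Cons.prems(1) ne by (auto simp: path_between_def successively_Cons)
    then obtain a b p where ab: "(a, b) \<in> parcs G"
      and p: "path_between (cart_prod G H) (a, hd ys) p (b, hd ys)"
        "snd ` set p \<subseteq> set ys" "length p = l'"
      using Cons.IH l' by blast
    obtain q where q: "path_between G a q b" "length q = l - l'"
      using edge_pancyclicD[OF G(2) ab l'(4,5)] by blast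
    \<comment> \<open>The new cycle follows \<open>q\<close> from \<open>a\<close> to
      \<open>b\<close> in the top copy and returns below along \<open>rev p\<close>. Cutting it at
      the first edge \<open>ac\<close> of \<open>q\<close> leaves a path from \<open>c\<close> to
      \<open>a\<close>.\<close>
    obtain c r where qc: "q = a # c # r"
      using q l'(4) by (cases q; cases "tl q") (auto simp: path_between_def)
    let ?row = "map (\<lambda>x. (x, y))"
    let ?new = "(?row (c # r) @ rev p) @ [(a, y)]"
    have ca: "(c, a) \<in> parcs G" and cb: "path_between G c (c # r) b" and "a \<notin> set (c # r)"
      using q(1) pair_graphD(3)[OF G(1)] unfolding qc by (auto simp: path_between_def)
    have aP: "path_between (cart_prod G H) (a, y) [(a, y)] (a, y)"
      using ab y(2) pair_graphD(2)[OF G(1)] by (auto simp: path_between_def cart_prod_def)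
    have link: "((b, y), (b, hd ys)) \<in> parcs (cart_prod G H)"
      "((a, hd ys), (a, y)) \<in> parcs (cart_prod G H)"
      using ab arc pair_graphD(2,3)[OF G(1)] pair_graphD(2,3)[OF H]
      by (auto simp: cart_prod_def)
    have disj: "(x, y) \<notin> set p" for x
      using p(2) y(3) by force
    have "path_between (cart_prod G H) (c, y) (?row (c # r) @ rev p) (a, hd ys)"
      by (rule path_between_append[OF path_between_cart_prod_row[OF cb y(2)]
            path_between_rev[OF pair_graph_cart_prod[OF G(1) H] p(1)] link(1)])
        (use disj in auto)
    then have "path_between (cart_prod G H) (c, y) ?new (a, y)"
      by (rule path_between_append[OF _ aP link(2)]) (use disj \<open>a \<notin> set (c # r)\<close> in auto)
    then show ?thesis
      using ca p q l' qc y
      by (intro exI[of _ c] exI[of _ a] exI[of _ ?new]) auto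
  qed
qed

section \<open>Iterated powers\<close>

text \<open>A product with the one-vertex power 0 only renames \<open>x\<close> to
  \<open>(x, [])\<close>, so the recursion step also covers exponent 1 and inductions can start at
  0.\<close>

lemma cart_power_Suc:
  assumes "pair_graph G"
  shows "cart_power G (Suc n) = relabel (\<lambda>(x, xs). x # xs) (cart_prod G (cart_power G n))"
proof (cases n)
  case 0
  have "pverts (cart_prod G (cart_power G 0)) = (\<lambda>x. (x, [])) ` pverts G"
    by (auto simp: cart_prod_def)
  moreover have "parcs (cart_prod G (cart_power G 0)) =
      map_prod (\<lambda>x. (x, [])) (\<lambda>x. (x, [])) ` parcs G"
    using pair_graphD(2)[OF assms] by (auto simp: cart_prod_def)
  ultimately show ?thesis
    unfolding 0 by (simp add: relabel_def image_image map_prod_def case_prod_beta)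
qed simp

text \<open>The largest \<open>l\<close> gives a Hamiltonian path for the next power; each
  \<open>l \<ge> 3\<close> gives a path that closes to a cycle.\<close>

lemma cart_power_Suc_paths:
  assumes G: "pair_graph G" "edge_pancyclic G" "card (pverts G) \<ge> 3" "parcs G \<noteq> {}"
    and ys: "path_between (cart_power G n) y ys z" "length ys = card (pverts G) ^ n"
    and l: "2 \<le> l" "l \<le> card (pverts G) ^ Suc n"
  shows "\<exists>u v p. (u, v) \<in> parcs (cart_power G (Suc n)) \<and>
           path_between (cart_power G (Suc n)) u p v \<and> length p = l"
proof -
  let ?P = "cart_prod G (cart_power G n)" and ?f = "\<lambda>(x, xs). x # xs"
  obtain a b p where ab: "(a, b) \<in> parcs G" and p: "path_between ?P (a, y) p (b, y)" "length p = l"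
    using cart_prod_path_paths[OF G pair_graph_cart_power[OF G(1)] ys(1) l(1)] l(2) ys(2) by auto
  have P: "parcs (cart_power G (Suc n)) = map_prod ?f ?f ` parcs ?P"
    "pverts (cart_power G (Suc n)) = ?f ` pverts ?P"
    unfolding cart_power_Suc[OF G(1)] by (simp_all add: relabel_def)
  have "y \<in> pverts (cart_power G n)"
    using ys(1) by (auto simp: path_between_def)
  then have "((a, y), (b, y)) \<in> parcs ?P"
    using ab pair_graphD(2)[OF G(1)] by (auto simp: cart_prod_def)
  then have "(?f (a, y), ?f (b, y)) \<in> parcs (cart_power G (Suc n))"
    unfolding P by (metis imageI map_prod_simp)
  moreover have "path_between (cart_power G (Suc n)) (?f (a, y)) (map ?f p) (?f (b, y))"
    by (rule path_between_map[OF p(1)])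
      (auto simp: P inj_on_def simp del: cart_power.simps intro!: rev_image_eqI)
  moreover have "length (map ?f p) = l"
    using p(2) by simp
  ultimately show ?thesis by (intro exI conjI)
qed

lemma cart_power_Hamiltonian_path:
  assumes G: "pair_graph G" "edge_pancyclic G" "card (pverts G) \<ge> 3" "parcs G \<noteq> {}"
  shows "\<exists>y ys z. path_between (cart_power G n) y ys z \<and> length ys = card (pverts G) ^ n"
proof (induction n)
  case 0
  have "path_between (cart_power G 0) [] [[]] [] \<and> length [[]] = card (pverts G) ^ 0"
    by (simp add: path_between_def)
  then show ?case by blast
next
  case (Suc n)
  obtain y ys z where ys: "path_between (cart_power G n) y ys z" "length ys = card (pverts G) ^ n"
    using Suc by blast
  have "card (pverts G) ^ 1 \<le> card (pverts G) ^ Suc n"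
    using G(3) by (intro power_increasing) auto
  then have "2 \<le> card (pverts G) ^ Suc n"
    using G(3) unfolding power_one_right by linarith
  from cart_power_Suc_paths[OF G ys this order.refl] show ?case
    by (elim exE conjE) (intro exI conjI)
qed

theorem pancyclic_cart_power:
  assumes G: "pair_graph G" "edge_pancyclic G" "card (pverts G) \<ge> 3" "parcs G \<noteq> {}"
    and n: "n \<ge> 1"
  shows "pancyclic (cart_power G n)"
  unfolding pancyclic_def
proof (intro allI impI)
  fix l
  assume l: "3 \<le> l \<and> l \<le> card (pverts (cart_power G n))"
  \<comment> \<open>For \<open>n = 1\<close> the stack over the single vertex of power 0 is one copy
    of \<open>G\<close>.\<close>
  obtain k where k: "n = Suc k"
    using n by (cases n) auto
  obtain y ys z where "path_between (cart_power G k) y ys z" "length ys = card (pverts G) ^ k"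
    using cart_power_Hamiltonian_path[OF G] by blast
  then obtain u v p where p: "(u, v) \<in> parcs (cart_power G n)"
    "path_between (cart_power G n) u p v" "length p = l"
    using cart_power_Suc_paths[OF G, of k y ys z l] l unfolding k card_cart_power by auto
  show "\<exists>p. pre_digraph.cycle (with_proj (cart_power G n)) p \<and> length p = l"
    using cycle_if_path_between[OF p(2) pair_graphD(3)[OF pair_graph_cart_power[OF G(1)] p(1)]]
    unfolding p(3) .
qed

section \<open>Edge-pancyclicity of \<open>K9_minus_C9\<close>\<close>

lemma parcs_K9_minus_C9:
  "(u, v) \<in> parcs K9_minus_C9 \<longleftrightarrow>
     u < 9 \<and> v < 9 \<and> u \<noteq> v \<and> v \<noteq> Suc u mod 9 \<and> u \<noteq> Suc v mod 9"
  by (auto simp: K9_minus_C9_def delete_edges_def complete_graph_def cycle_graph_def)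

lemma pverts_K9_minus_C9: "pverts K9_minus_C9 = {..<9}"
  by (simp add: K9_minus_C9_def delete_edges_def complete_graph_def)

text \<open>
  Up to rotation and reversal, every edge is \<open>0d\<close> with \<open>d\<close> in \<open>{2, 3, 4}\<close>. For each such \<open>d\<close>, the table
  has one path from \<open>0\<close> to \<open>d\<close> for each number of vertices from 2 to 9.
\<close>

definition paths_table :: "nat list list" where
  "paths_table =
    [[0, 2], [0, 4, 2], [0, 3, 5, 2], [0, 3, 1, 4, 2], [0, 3, 1, 4, 6, 2], [0, 3, 1, 4, 6, 8, 2],
     [0, 3, 1, 4, 6, 8, 5, 2], [0, 3, 1, 4, 6, 8, 5, 7, 2],
     [0, 3], [0, 5, 3], [0, 2, 5, 3], [0, 2, 4, 1, 3], [0, 2, 4, 1, 5, 3], [0, 2, 4, 1, 5, 7, 3],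
     [0, 2, 4, 1, 5, 8, 6, 3], [0, 2, 4, 1, 6, 8, 5, 7, 3],
     [0, 4], [0, 2, 4], [0, 2, 6, 4], [0, 2, 5, 1, 4], [0, 2, 5, 1, 6, 4], [0, 2, 5, 1, 3, 6, 4],
     [0, 2, 5, 1, 3, 6, 8, 4], [0, 2, 5, 1, 6, 8, 3, 7, 4]]"

lemma paths_table_path:
  "p \<in> set paths_table \<Longrightarrow> path_between K9_minus_C9 0 p (last p)"
  unfolding paths_table_def list.set
  by (elim insertE emptyE)
    (simp_all add: path_between_def parcs_K9_minus_C9 pverts_K9_minus_C9)

lemma paths_table_complete:
  assumes "d \<in> {2, 3, 4}" "2 \<le> k" "k \<le> 9"
  shows "\<exists>p \<in> set paths_table. length p = k \<and> last p = d"
proof -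
  have "k \<in> {2, 3, 4, 5, 6, 7, 8, 9}" using assms by auto
  then show ?thesis
    using assms(1) unfolding paths_table_def by (elim insertE emptyE) simp_all
qed

lemma add_mod_cancel: "(x + c) mod n = (y + c) mod n \<longleftrightarrow> x mod n = y mod n" for x y c n :: nat
proof -
  \<comment> \<open>Over the integers, congruence means that \<open>n\<close> divides the
    difference, where \<open>c\<close> cancels.\<close>
  have "int ((x + c) mod n) = int ((y + c) mod n) \<longleftrightarrow> int (x mod n) = int (y mod n)"
    unfolding of_nat_mod of_nat_add by (simp add: mod_eq_dvd_iff)
  then show ?thesis
    unfolding of_nat_eq_iff .
qed

lemma rotation_arc:
  assumes "(u, v) \<in> parcs K9_minus_C9"
  shows "((u + c) mod 9, (v + c) mod 9) \<in> parcs K9_minus_C9"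
proof -
  \<comment> \<open>Rotation commutes with the cyclic successor, hence preserves non-adjacency in
    the deleted cycle.\<close>
  have "Suc ((x + c) mod 9) mod 9 = (Suc x + c) mod 9" for x
    by (simp add: mod_simps)
  then show ?thesis
    using assms by (simp add: parcs_K9_minus_C9 add_mod_cancel del: add_Suc)
qed

lemma inj_rotation: "inj_on (\<lambda>x. (x + c) mod 9) {..<9::nat}"
  by (rule inj_onI) (simp add: add_mod_cancel)

text \<open>The ends of an arc differ by 2 to 7 modulo 9, and reversal exchanges \<open>d\<close>
  with \<open>9 - d\<close>. The proof checks all pairs.\<close>

lemma arc_up_to_rotation_and_reversal:
  assumes "(a, b) \<in> parcs K9_minus_C9"
  shows "\<exists>d \<in> {2, 3, 4}. b = (d + a) mod 9 \<or> a = (d + b) mod 9"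
proof -
  have "x \<in> {0, 1, 2, 3, 4, 5, 6, 7, 8}" if "x < 9" for x :: nat
    using that unfolding insert_iff empty_iff by arith
  then have "a \<in> {0, 1, 2, 3, 4, 5, 6, 7, 8}" "b \<in> {0, 1, 2, 3, 4, 5, 6, 7, 8}"
    using assms unfolding parcs_K9_minus_C9 by blast+
  then show ?thesis
    using assms unfolding parcs_K9_minus_C9
    by (elim insertE emptyE) simp_all
qed

lemma edge_pancyclic_K9_minus_C9: "edge_pancyclic K9_minus_C9"
proof -
  have rot: "\<exists>p. path_between K9_minus_C9 a p b \<and> length p = k"
    if ab: "a < 9" "b = (d + a) mod 9" "d \<in> {2, 3, 4}" and k: "2 \<le> k" "k \<le> 9" for a b d k :: nat
  proof -
    obtain p where p: "path_between K9_minus_C9 0 p d" "length p = k"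
      using paths_table_complete[OF ab(3) k] paths_table_path by metis
    \<comment> \<open>Rotation by \<open>a\<close> carries 0 to \<open>a\<close> and
      \<open>d\<close> to \<open>b\<close>.\<close>
    have "path_between K9_minus_C9 ((0 + a) mod 9) (map (\<lambda>x. (x + a) mod 9) p) ((d + a) mod 9)"
      by (rule path_between_map[OF p(1)])
        (auto simp: pverts_K9_minus_C9 inj_rotation intro: rotation_arc)
    then show ?thesis
      using p(2) ab by auto
  qed
  have "\<exists>p. path_between K9_minus_C9 a p b \<and> length p = k"
    if ab: "(a, b) \<in> parcs K9_minus_C9" and k: "2 \<le> k" "k \<le> 9" for a b k
  proof -
    have "a < 9" "b < 9"
      using ab by (auto simp: parcs_K9_minus_C9)
    \<comment> \<open>If instead \<open>a = (d + b) mod 9\<close>, the rotated path runs from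
      \<open>b\<close> to \<open>a\<close> and is reversed.\<close>
    then show ?thesis
      using arc_up_to_rotation_and_reversal[OF ab] rot[OF _ _ _ k] path_between_rev[OF pair_graph_K9_minus_C9]
      by (metis length_rev)
  qed
  then show ?thesis
    by (auto simp: edge_pancyclic_def pverts_K9_minus_C9)
qed

theorem mainTheorem1:
  fixes n :: nat
  assumes "n \<ge> 1"
  shows "pancyclic (cart_power K9_minus_C9 n)"
proof (rule pancyclic_cart_power)
  have "(0, 2) \<in> parcs K9_minus_C9"
    by (simp add: parcs_K9_minus_C9)
  then show "parcs K9_minus_C9 \<noteq> {}" by blast
qed (use assms in \<open>simp_all add: pair_graph_K9_minus_C9 edge_pancyclic_K9_minus_C9
  pverts_K9_minus_C9\<close>)

end
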